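(* Let $0<\gamma<1$, $\lambda>0$, and let $X$ be a $\mathrm{PDS}(\gamma,\lambda)$ random variable. Let $Y$ be a tempered stable random variable with characteristic function $$f_Y(t)=\exp\left\{-\left(\lambda^{1/\gamma}-\mathrm{i}t\right)^{\gamma}+\lambda\right\}.$$ Then for every $k\in\mathbb{N}_0$ $$\mathbb{P}(X=k)=e^{-\lambda}\,\frac{\lambda^{k/\gamma}}{k!}\,\mathrm{E}\,Y^k.$$
   Context: For $\gamma\in(0,1]$ and $\lambda>0$, $\mathrm{PDS}(\gamma,\lambda)$ denotes the distribution on $\mathbb{N}_0$ with probability generating function $\mathrm{E}z^X=\exp\{-\lambda(1-z)^\gamma\}$. Complex powers are principal values. *)

theory Defs
  imports "HOL-Probability.Probability"
begin

definition pgf :: "nat measure \<Rightarrow> complex \<Rightarrow> complex" where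
  "pgf \<mu> z = (CLINT n|\<mu>. z ^ n)"

text \<open>
  The generating function is prescribed on the closed complex unit disc, where \<open>z ^ n\<close> is bounded
  and hence integrable. There \<open>Re (1 - z) \<ge> 0\<close>, so \<open>powr\<close> is the principal power; at \<open>z = 1\<close> it
  takes the intended value \<open>0 powr \<gamma> = 0\<close>.
\<close>
definition is_PDS :: "real \<Rightarrow> real \<Rightarrow> nat measure \<Rightarrow> bool" where
  "is_PDS \<gamma> lam \<mu> \<longleftrightarrow>
     0 < \<gamma> \<and> \<gamma> \<le> 1 \<and> 0 < lam \<and>
     prob_space \<mu> \<and> sets \<mu> = sets (count_space UNIV) \<and>
     (\<forall>z. norm z \<le> 1 \<longrightarrow>
        pgf \<mu> z = exp (- (complex_of_real lam * (1 - z) powr complex_of_real \<gamma>)))"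

end

theory Submission
  imports Defs "HOL-Complex_Analysis.Complex_Analysis" "HOL-Real_Asymp.Real_Asymp"
begin

text \<open>
  Put \<open>c = \<lambda> powr (1 / \<gamma>)\<close> and \<open>G s = exp (- (c - s) powr \<gamma> + \<lambda>)\<close>. This function is holomorphic on the
  half-plane \<open>Re s < c\<close> and governs both laws. On the imaginary axis it is the characteristic
  function of \<open>Y\<close>. Since \<open>c powr \<gamma> = \<lambda>\<close>, also \<open>\<lambda> (1 - z) powr \<gamma> = (c - c z) powr \<gamma>\<close>, so the generating
  function of \<open>X\<close> on the unit disc is \<open>exp (- \<lambda>) * G (c z)\<close>. Comparing Taylor coefficients at \<open>0\<close>,

    \<open>P (X = k) = exp (- \<lambda>) * c ^ k / k! * (deriv ^^ k) G 0\<close>,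

  and it remains to see that \<open>(deriv ^^ k) G 0\<close> is the \<open>k\<close>-th moment of \<open>Y\<close>. The existence of the
  moments is the substantial point, because only the characteristic function is known. It is
  obtained by induction in steps of two (\<open>moments_eq_higher_deriv\<close>): if \<open>n\<close> is even and the Fourier
  transform of the nonnegative weight \<open>Y ^ n\<close> is \<open>(deriv ^^ n) G\<close> on the imaginary axis, then its
  second differences at \<open>0\<close> are of order \<open>h\<^sup>2\<close>, and Fatou's lemma makes \<open>Y ^ (n + 2)\<close> integrable
  (\<open>integrable_mult_square_if_second_difference_bounded\<close>). Two differentiations under the integral
  sign (\<open>has_vector_derivative_integral_iexp\<close>) then carry the identity from \<open>n\<close> to \<open>n + 1\<close> and \<open>n + 2\<close>.
\<close>

section \<open>Differentiating a Fourier transform\<close>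

text \<open>
  In this form, pointwise and integrated derivatives are both limits of sequences of difference
  quotients, to which dominated convergence applies.
\<close>
lemma has_vector_derivative_iff_difference_quotient:
  fixes f :: "real \<Rightarrow> 'b::real_normed_vector"
  shows "(f has_vector_derivative D) (at t) \<longleftrightarrow> ((\<lambda>s. (f s - f t) /\<^sub>R (s - t)) \<longlongrightarrow> D) (at t)"
proof -
  have "(f has_vector_derivative D) (at t) \<longleftrightarrow>
      ((\<lambda>s. norm (f s - f t - (s - t) *\<^sub>R D) / norm (s - t)) \<longlongrightarrow> 0) (at t)"
    by (simp add: has_vector_derivative_def has_derivative_iff_norm bounded_linear_scaleR_left)
  also have "\<dots> \<longleftrightarrow> ((\<lambda>s. norm ((f s - f t) /\<^sub>R (s - t) - D)) \<longlongrightarrow> 0) (at t)"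
  proof (rule filterlim_cong[OF refl refl])
    show "\<forall>\<^sub>F s in at t. norm (f s - f t - (s - t) *\<^sub>R D) / norm (s - t)
        = norm ((f s - f t) /\<^sub>R (s - t) - D)"
      unfolding eventually_at_filter
    proof (intro always_eventually allI impI)
      fix s assume "s \<noteq> t"
      then have "(f s - f t) /\<^sub>R (s - t) - D = (f s - f t - (s - t) *\<^sub>R D) /\<^sub>R (s - t)"
        by (simp add: scaleR_diff_right)
      then show "norm (f s - f t - (s - t) *\<^sub>R D) / norm (s - t) = norm ((f s - f t) /\<^sub>R (s - t) - D)"
        by (simp add: divide_inverse mult.commute)
    qed
  qed
  also have "\<dots> \<longleftrightarrow> ((\<lambda>s. (f s - f t) /\<^sub>R (s - t)) \<longlongrightarrow> D) (at t)"
    by (simp add: tendsto_norm_zero_iff LIM_zero_iff)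
  finally show ?thesis .
qed

text \<open>
  The difference quotients of \<open>t \<mapsto> iexp (t * y)\<close> are bounded by \<open>\<bar>y\<bar>\<close>, so those of the integrand are
  dominated by the integrable function \<open>cmod (f * Y)\<close>.
\<close>
lemma has_vector_derivative_integral_iexp:
  fixes Y :: "'a \<Rightarrow> real" and f :: "'a \<Rightarrow> complex"
  assumes f: "integrable N f" and fY: "integrable N (\<lambda>\<omega>. f \<omega> * of_real (Y \<omega>))"
    and [measurable]: "Y \<in> borel_measurable N"
  shows "((\<lambda>t. CLINT \<omega>|N. f \<omega> * iexp (t * Y \<omega>)) has_vector_derivative
           (CLINT \<omega>|N. \<i> * (f \<omega> * of_real (Y \<omega>)) * iexp (t * Y \<omega>))) (at t)"
proof -
  have [measurable]: "f \<in> borel_measurable N" using f by auto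
  have int: "integrable N (\<lambda>\<omega>. f \<omega> * iexp (s * Y \<omega>))" for s
    by (rule Bochner_Integration.integrable_bound[OF f]) (auto simp: norm_mult)
  show ?thesis
    unfolding has_vector_derivative_iff_difference_quotient tendsto_at_iff_sequentially comp_def
  proof (intro allI impI)
    fix S :: "nat \<Rightarrow> real" assume S: "\<forall>i. S i \<in> UNIV - {t}" "S \<longlonglongrightarrow> t"
    let ?q = "\<lambda>i \<omega>. (f \<omega> * iexp (S i * Y \<omega>) - f \<omega> * iexp (t * Y \<omega>)) /\<^sub>R (S i - t)"
    have "(\<lambda>i. integral\<^sup>L N (?q i)) \<longlonglongrightarrow>
        (CLINT \<omega>|N. \<i> * (f \<omega> * of_real (Y \<omega>)) * iexp (t * Y \<omega>))"
    proof (rule integral_dominated_convergence[OF _ _ integrable_norm[OF fY]])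
      show "AE \<omega> in N. (\<lambda>i. ?q i \<omega>) \<longlonglongrightarrow> \<i> * (f \<omega> * of_real (Y \<omega>)) * iexp (t * Y \<omega>)"
      proof (rule AE_I2)
        fix \<omega>
        have "((\<lambda>s. f \<omega> * iexp (s * Y \<omega>)) has_vector_derivative
            \<i> * (f \<omega> * of_real (Y \<omega>)) * iexp (t * Y \<omega>)) (at t)"
        proof -
          have "((\<lambda>s. f \<omega> * exp (\<i> * (s * of_real (Y \<omega>)))) has_field_derivative
              \<i> * (f \<omega> * of_real (Y \<omega>)) * iexp (t * Y \<omega>)) (at (of_real t))"
            by (auto intro!: derivative_eq_intros simp: algebra_simps)
          from has_vector_derivative_real_field[OF this] show ?thesis by simp
        qed
        then show "(\<lambda>i. ?q i \<omega>) \<longlonglongrightarrow> \<i> * (f \<omega> * of_real (Y \<omega>)) * iexp (t * Y \<omega>)"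
          unfolding has_vector_derivative_iff_difference_quotient tendsto_at_iff_sequentially comp_def
          using S by blast
      qed
      show "AE \<omega> in N. cmod (?q i \<omega>) \<le> cmod (f \<omega> * of_real (Y \<omega>))" for i
      proof (rule AE_I2)
        fix \<omega>
        have ne: "S i \<noteq> t" using S by auto
        have "iexp (S i * Y \<omega>) - iexp (t * Y \<omega>) = iexp (t * Y \<omega>) * (iexp ((S i - t) * Y \<omega>) - 1)"
          by (simp add: algebra_simps flip: exp_add)
        then have "cmod (iexp (S i * Y \<omega>) - iexp (t * Y \<omega>)) = cmod (iexp ((S i - t) * Y \<omega>) - 1)"
          by (simp add: norm_mult)
        also have "\<dots> \<le> \<bar>(S i - t) * Y \<omega>\<bar>"
          using iexp_approx1[of "(S i - t) * Y \<omega>" 0] by simp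
        finally have "cmod (iexp (S i * Y \<omega>) - iexp (t * Y \<omega>)) / \<bar>S i - t\<bar> \<le> \<bar>Y \<omega>\<bar>"
          using ne unfolding abs_mult by (simp add: pos_divide_le_eq mult.commute)
        then have "cmod (f \<omega>) * (cmod (iexp (S i * Y \<omega>) - iexp (t * Y \<omega>)) / \<bar>S i - t\<bar>)
            \<le> cmod (f \<omega>) * \<bar>Y \<omega>\<bar>"
          by (rule mult_left_mono) simp
        then show "cmod (?q i \<omega>) \<le> cmod (f \<omega> * of_real (Y \<omega>))"
          by (simp add: norm_mult divide_inverse mult_ac flip: right_diff_distrib)
      qed
    qed simp_all
    moreover have "integral\<^sup>L N (?q i) =
        ((CLINT \<omega>|N. f \<omega> * iexp (S i * Y \<omega>)) - (CLINT \<omega>|N. f \<omega> * iexp (t * Y \<omega>))) /\<^sub>R (S i - t)" for i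
      using int by (simp only: integral_scaleR_right Bochner_Integration.integral_diff)
    ultimately show "(\<lambda>i. ((CLINT \<omega>|N. f \<omega> * iexp (S i * Y \<omega>)) - (CLINT \<omega>|N. f \<omega> * iexp (t * Y \<omega>)))
         /\<^sub>R (S i - t)) \<longlonglongrightarrow> (CLINT \<omega>|N. \<i> * (f \<omega> * of_real (Y \<omega>)) * iexp (t * Y \<omega>))"
      by (simp only:)
  qed
qed

section \<open>Integrability from second differences\<close>

lemma tendsto_second_difference_cos:
  fixes y :: real
  shows "((\<lambda>h. (2 - 2 * cos (h * y)) / h\<^sup>2) \<longlongrightarrow> y\<^sup>2) (at 0)"
proof -
  have "((\<lambda>h. sin (h * (y / 2))) has_field_derivative y / 2) (at 0)"
    by (auto intro!: derivative_eq_intros)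
  then have "((\<lambda>h. sin (h * (y / 2)) / h) \<longlongrightarrow> y / 2) (at 0)"
    by (simp add: has_field_derivative_iff)
  then have "((\<lambda>h. 4 * (sin (h * (y / 2)) / h)\<^sup>2) \<longlongrightarrow> 4 * (y / 2)\<^sup>2) (at 0)"
    by (intro tendsto_mult_left tendsto_power)
  moreover have "(\<lambda>h. 4 * (sin (h * (y / 2)) / h)\<^sup>2) = (\<lambda>h. (2 - 2 * cos (h * y)) / h\<^sup>2)"
  proof
    fix h show "4 * (sin (h * (y / 2)) / h)\<^sup>2 = (2 - 2 * cos (h * y)) / h\<^sup>2"
      using cos_double_sin[of "h * (y / 2)"] by (simp add: power_divide)
  qed
  ultimately show ?thesis by (simp add: power_divide)
qed

text \<open>
  The second difference of the Fourier transform \<open>\<Phi>\<close> of the weight \<open>w\<close> is the integral of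
  \<open>w * (2 - 2 * cos (h * Y))\<close>, which is nonnegative. After division by \<open>h\<^sup>2\<close> the integrands converge to
  \<open>w * Y\<^sup>2\<close> as \<open>h\<close> tends to \<open>0\<close> while their integrals stay below \<open>B\<close>; Fatou's lemma does the rest.
\<close>
lemma integrable_mult_square_if_second_difference_bounded:
  fixes Y w :: "'a \<Rightarrow> real" and \<Phi> :: "real \<Rightarrow> complex"
  assumes w: "integrable N w" and nonneg: "\<And>\<omega>. 0 \<le> w \<omega>"
    and [measurable]: "Y \<in> borel_measurable N"
    and \<Phi>: "\<And>t. (CLINT \<omega>|N. of_real (w \<omega>) * iexp (t * Y \<omega>)) = \<Phi> t"
    and "0 < r" and bound: "\<And>h. 0 < h \<Longrightarrow> h < r \<Longrightarrow> cmod (2 * \<Phi> 0 - \<Phi> h - \<Phi> (- h)) \<le> B * h\<^sup>2"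
  shows "integrable N (\<lambda>\<omega>. w \<omega> * (Y \<omega>)\<^sup>2)"
proof -
  have [measurable]: "w \<in> borel_measurable N" using w by auto
  have int: "integrable N (\<lambda>\<omega>. of_real (w \<omega>) * iexp (s * Y \<omega>))" for s
    by (rule Bochner_Integration.integrable_bound[OF w]) (auto simp: norm_mult)
  define v where "v = (\<lambda>h \<omega>. w \<omega> * ((2 - 2 * cos (h * Y \<omega>)) / h\<^sup>2))"
  have v_nonneg: "0 \<le> v h \<omega>" for h \<omega> by (simp add: v_def nonneg)
  have v_bound: "(\<integral>\<^sup>+\<omega>. v h \<omega> \<partial>N) \<le> ennreal B" if h: "0 < h" "h < r" for h
  proof -
    have "integrable N (\<lambda>\<omega>. w \<omega> * (2 - 2 * cos (h * Y \<omega>)))"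
    proof (rule Bochner_Integration.integrable_bound[of _ "\<lambda>\<omega>. 4 * w \<omega>"])
      show "AE \<omega> in N. norm (w \<omega> * (2 - 2 * cos (h * Y \<omega>))) \<le> norm (4 * w \<omega>)"
      proof (rule AE_I2)
        fix \<omega>
        have "\<bar>2 - 2 * cos (h * Y \<omega>)\<bar> \<le> 4"
          using cos_ge_minus_one[of "h * Y \<omega>"] cos_le_one[of "h * Y \<omega>"] by linarith
        then show "norm (w \<omega> * (2 - 2 * cos (h * Y \<omega>))) \<le> norm (4 * w \<omega>)"
          using mult_left_mono[of "\<bar>2 - 2 * cos (h * Y \<omega>)\<bar>" 4 "w \<omega>"] nonneg[of \<omega>]
            by (simp add: abs_mult mult.commute)
      qed
    qed (use w in auto)
    then have v_int: "integrable N (v h)"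
      using integrable_mult_right[of "1 / h\<^sup>2" N "\<lambda>\<omega>. w \<omega> * (2 - 2 * cos (h * Y \<omega>))"]
      unfolding v_def by simp
    have "2 * \<Phi> 0 - \<Phi> h - \<Phi> (- h) = (CLINT \<omega>|N. 2 * (of_real (w \<omega>) * iexp (0 * Y \<omega>))
        - of_real (w \<omega>) * iexp (h * Y \<omega>) - of_real (w \<omega>) * iexp ((- h) * Y \<omega>))"
      using int[of 0] int[of h] int[of "- h"] unfolding \<Phi>[symmetric] by simp
    also have "\<dots> = (CLINT \<omega>|N. of_real (h\<^sup>2 * v h \<omega>))"
    proof (rule Bochner_Integration.integral_cong[OF refl])
      fix \<omega>
      have "iexp (h * Y \<omega>) + iexp ((- h) * Y \<omega>) = of_real (2 * cos (h * Y \<omega>))"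
        by (simp add: complex_eq_iff Re_exp Im_exp)
      then show "2 * (of_real (w \<omega>) * iexp (0 * Y \<omega>)) - of_real (w \<omega>) * iexp (h * Y \<omega>)
          - of_real (w \<omega>) * iexp ((- h) * Y \<omega>) = complex_of_real (h\<^sup>2 * v h \<omega>)"
        using h unfolding v_def
        by (simp add: diff_diff_eq flip: distrib_left) (simp add: algebra_simps)
    qed
    also have "\<dots> = of_real (h\<^sup>2 * (LINT \<omega>|N. v h \<omega>))"
      by (simp add: integral_complex_of_real del: of_real_mult)
    finally have eq: "2 * \<Phi> 0 - \<Phi> h - \<Phi> (- h) = of_real (h\<^sup>2 * (LINT \<omega>|N. v h \<omega>))" .
    have "h\<^sup>2 * (LINT \<omega>|N. v h \<omega>) \<le> B * h\<^sup>2"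
      using bound[OF h] unfolding eq norm_of_real by linarith
    then have "(LINT \<omega>|N. v h \<omega>) \<le> B"
      using h by (simp add: mult.commute)
    then show ?thesis
      using v_int v_nonneg by (simp add: nn_integral_eq_integral ennreal_leI)
  qed
  (* Any positive null sequence below r serves; Fatou's lemma is about sequences. *)
  define h where "h = (\<lambda>m::nat. r / real (m + 2))"
  have h: "0 < h m" "h m < r" for m using \<open>0 < r\<close> by (auto simp: h_def field_simps add_pos_nonneg)
  have "h \<longlonglongrightarrow> 0" unfolding h_def by real_asymp
  then have h0: "filterlim h (at 0) sequentially"
    using h(1) by (simp add: filterlim_at less_imp_neq[THEN not_sym])
  have "(\<integral>\<^sup>+\<omega>. ennreal (w \<omega> * (Y \<omega>)\<^sup>2) \<partial>N) = (\<integral>\<^sup>+\<omega>. liminf (\<lambda>m. ennreal (v (h m) \<omega>)) \<partial>N)"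
  proof (rule nn_integral_cong)
    fix \<omega>
    have "(\<lambda>m. v (h m) \<omega>) \<longlonglongrightarrow> w \<omega> * (Y \<omega>)\<^sup>2"
      unfolding v_def
      by (intro tendsto_mult_left filterlim_compose[OF tendsto_second_difference_cos h0])
    then have "(\<lambda>m. ennreal (v (h m) \<omega>)) \<longlonglongrightarrow> ennreal (w \<omega> * (Y \<omega>)\<^sup>2)"
      by (rule tendsto_ennrealI)
    then show "ennreal (w \<omega> * (Y \<omega>)\<^sup>2) = liminf (\<lambda>m. ennreal (v (h m) \<omega>))"
      by (simp add: lim_imp_Liminf)
  qed
  also have "\<dots> \<le> liminf (\<lambda>m. \<integral>\<^sup>+\<omega>. ennreal (v (h m) \<omega>) \<partial>N)"
    by (rule nn_integral_liminf) (simp add: v_def)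
  also have "\<dots> \<le> ennreal B"
    using v_bound[OF h] by (intro Liminf_le always_eventually) auto
  finally have "(\<integral>\<^sup>+\<omega>. ennreal (norm (w \<omega> * (Y \<omega>)\<^sup>2)) \<partial>N) < \<infinity>"
    using nonneg by (simp add: le_less_trans)
  then show ?thesis by (intro integrableI_bounded) auto
qed

text \<open>
  The linear Taylor terms at \<open>z\<close> and \<open>- z\<close> cancel, and the two remainders are controlled by
  the size of the second derivative on a closed disc in \<open>S\<close>.
\<close>
lemma holomorphic_second_difference_bound:
  fixes g :: "complex \<Rightarrow> complex"
  assumes g: "g holomorphic_on S" and S: "open S" "0 \<in> S"
  obtains r B where "0 < r"
    "\<And>z. cmod z < r \<Longrightarrow> cmod (2 * g 0 - g z - g (- z)) \<le> B * (cmod z)\<^sup>2"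
proof -
  obtain r where r: "0 < r" "cball 0 r \<subseteq> S"
    using S by (auto simp: open_contains_cball)
  have "continuous_on (cball 0 r) ((deriv ^^ 2) g)"
    using g r S by (meson continuous_on_subset holomorphic_higher_deriv holomorphic_on_imp_continuous_on)
  then have "bounded ((deriv ^^ 2) g ` cball 0 r)"
    by (intro compact_imp_bounded compact_continuous_image) auto
  then obtain B where B: "\<And>z. z \<in> cball 0 r \<Longrightarrow> cmod ((deriv ^^ 2) g z) \<le> B"
    unfolding bounded_iff by blast
  have taylor: "cmod (g z - (g 0 + deriv g 0 * z)) \<le> B * (cmod z)\<^sup>2" if "z \<in> cball 0 r" for z
  proof -
    have "cmod ((deriv ^^ 0) g z - (\<Sum>i\<le>1. (deriv ^^ i) g 0 * (z - 0) ^ i / fact i))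
        \<le> B * cmod (z - 0) ^ Suc 1 / fact 1"
    proof (rule complex_Taylor[where S = "cball 0 r" and f = "\<lambda>i. (deriv ^^ i) g" and n = 1])
      show "((deriv ^^ i) g has_field_derivative (deriv ^^ Suc i) g x) (at x within cball 0 r)"
        if "x \<in> cball 0 r" for i x
        using that r(2)
        by (intro has_field_derivative_higher_deriv[OF g S(1), THEN has_field_derivative_at_within]) blast
      show "cmod ((deriv ^^ Suc 1) g x) \<le> B" if "x \<in> cball 0 r" for x
        using B[OF that] by (simp only: Suc_1)
    qed (use that r(1) in \<open>simp_all only: convex_cball centre_in_cball less_imp_le\<close>)
    then show ?thesis by (simp add: power2_eq_square)
  qed
  show thesis
  proof (rule that[of r "2 * B"])
    fix z :: complex assume "cmod z < r"
    then have "z \<in> cball 0 r" "- z \<in> cball 0 r" by auto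
    note * = taylor[OF this(1)] taylor[OF this(2)]
    have "2 * g 0 - g z - g (- z)
        = - ((g z - (g 0 + deriv g 0 * z)) + (g (- z) - (g 0 + deriv g 0 * (- z))))"
      by simp
    then have "cmod (2 * g 0 - g z - g (- z))
        \<le> cmod (g z - (g 0 + deriv g 0 * z)) + cmod (g (- z) - (g 0 + deriv g 0 * (- z)))"
      by (metis norm_minus_cancel norm_triangle_ineq)
    then show "cmod (2 * g 0 - g z - g (- z)) \<le> 2 * B * (cmod z)\<^sup>2"
      using * by simp
  qed (use r in auto)
qed

section \<open>Moments as derivatives of the characteristic function\<close>

text \<open>
  The induction carries the whole Fourier transform of \<open>Y ^ n\<close>, not only its value at \<open>0\<close>: the second
  differences and the derivatives needed for the next step are those of this transform.
\<close>
lemma moments_eq_higher_deriv: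
  fixes Y :: "'a \<Rightarrow> real"
  assumes N: "prob_space N" and [measurable]: "Y \<in> borel_measurable N"
    and G: "G holomorphic_on S" and S: "open S" "\<And>t::real. \<i> * of_real t \<in> S"
    and char: "\<And>t. char (distr N borel Y) t = G (\<i> * of_real t)"
  shows "integrable N (\<lambda>\<omega>. Y \<omega> ^ n)"
    and "of_real (LINT \<omega>|N. Y \<omega> ^ n) = (deriv ^^ n) G 0"
proof -
  interpret prob_space N by fact
  define P where "P n \<longleftrightarrow> integrable N (\<lambda>\<omega>. Y \<omega> ^ n) \<and>
    (\<forall>t. (CLINT \<omega>|N. of_real (Y \<omega> ^ n) * iexp (t * Y \<omega>)) = (deriv ^^ n) G (\<i> * of_real t))" for n
  have P0: "P 0"
    using char unfolding P_def char_def by (simp add: integral_distr)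
  have P_Suc: "P (Suc n)" if n: "P n" and int: "integrable N (\<lambda>\<omega>. Y \<omega> ^ Suc n)" for n
    unfolding P_def
  proof (intro conjI allI int)
    fix t
    have d1: "((\<lambda>t. CLINT \<omega>|N. of_real (Y \<omega> ^ n) * iexp (t * Y \<omega>)) has_vector_derivative
       (CLINT \<omega>|N. \<i> * (of_real (Y \<omega> ^ n) * of_real (Y \<omega>)) * iexp (t * Y \<omega>))) (at t)"
    proof (rule has_vector_derivative_integral_iexp)
      show "integrable N (\<lambda>\<omega>. complex_of_real (Y \<omega> ^ n))"
        using n by (simp add: P_def del: of_real_power)
      show "integrable N (\<lambda>\<omega>. complex_of_real (Y \<omega> ^ n) * complex_of_real (Y \<omega>))"
        using integrable_of_real[OF int, where 'a = complex] by (simp add: mult.commute)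
    qed simp
    have d2: "((\<lambda>t. (deriv ^^ n) G (\<i> * of_real t)) has_vector_derivative
        \<i> * (deriv ^^ Suc n) G (\<i> * of_real t)) (at t)"
    proof -
      have "((\<lambda>t. \<i> * of_real t) has_vector_derivative \<i>) (at t)"
        by (auto intro!: derivative_eq_intros)
      from field_vector_diff_chain_at[OF this has_field_derivative_higher_deriv[OF G S]]
      show ?thesis by (simp add: comp_def)
    qed
    have eq: "(\<lambda>t. CLINT \<omega>|N. of_real (Y \<omega> ^ n) * iexp (t * Y \<omega>))
        = (\<lambda>t. (deriv ^^ n) G (\<i> * of_real t))"
      using n by (simp add: P_def fun_eq_iff)
    have "(CLINT \<omega>|N. \<i> * (of_real (Y \<omega> ^ n) * of_real (Y \<omega>)) * iexp (t * Y \<omega>))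
        = \<i> * (deriv ^^ Suc n) G (\<i> * of_real t)"
      using d1 d2 unfolding eq by (rule vector_derivative_unique_at)
    moreover have "(CLINT \<omega>|N. \<i> * (of_real (Y \<omega> ^ n) * of_real (Y \<omega>)) * iexp (t * Y \<omega>))
        = \<i> * (CLINT \<omega>|N. of_real (Y \<omega> ^ Suc n) * iexp (t * Y \<omega>))"
      by (simp add: mult_ac flip: integral_mult_right_zero)
    ultimately show "(CLINT \<omega>|N. of_real (Y \<omega> ^ Suc n) * iexp (t * Y \<omega>))
        = (deriv ^^ Suc n) G (\<i> * of_real t)"
      by simp
  qed
  (* Evenness makes Y ^ n an admissible nonnegative weight. Integrability is gained at n + 2 first;
     the exponent n + 1 is then covered by domination. *)
  have P_Suc_Suc: "P (Suc n) \<and> P (Suc (Suc n))" if n: "P n" and even: "even n" for n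
  proof -
    have "0 \<in> S" using S(2)[of 0] by simp
    then obtain r B where r: "0 < r" and B: "\<And>z. cmod z < r \<Longrightarrow>
        cmod (2 * (deriv ^^ n) G 0 - (deriv ^^ n) G z - (deriv ^^ n) G (- z)) \<le> B * (cmod z)\<^sup>2"
      using holomorphic_second_difference_bound[OF holomorphic_higher_deriv[OF G S(1)] S(1)] by metis
    have "integrable N (\<lambda>\<omega>. Y \<omega> ^ n * (Y \<omega>)\<^sup>2)"
    proof (rule integrable_mult_square_if_second_difference_bounded)
      show "cmod (2 * (deriv ^^ n) G (\<i> * of_real 0) - (deriv ^^ n) G (\<i> * of_real h)
          - (deriv ^^ n) G (\<i> * of_real (- h))) \<le> B * h\<^sup>2" if "0 < h" "h < r" for h
        using B[of "\<i> * of_real h"] that by (simp add: norm_mult)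
    qed (use n even r in \<open>auto simp: P_def zero_le_even_power simp del: of_real_power\<close>)
    then have int2: "integrable N (\<lambda>\<omega>. Y \<omega> ^ Suc (Suc n))"
      by (simp add: power2_eq_square mult_ac)
    have "integrable N (\<lambda>\<omega>. Y \<omega> ^ Suc n)"
    proof (rule Bochner_Integration.integrable_bound)
      show "integrable N (\<lambda>\<omega>. 1 + \<bar>Y \<omega> ^ Suc (Suc n)\<bar>)" using int2 by auto
      show "AE \<omega> in N. norm (Y \<omega> ^ Suc n) \<le> norm (1 + \<bar>Y \<omega> ^ Suc (Suc n)\<bar>)"
      proof (rule AE_I2)
        fix \<omega>
        have "\<bar>Y \<omega>\<bar> ^ Suc n \<le> 1 + \<bar>Y \<omega>\<bar> ^ Suc (Suc n)"
        proof (cases "\<bar>Y \<omega>\<bar> \<le> 1")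
          case True
          then have "\<bar>Y \<omega>\<bar> ^ Suc n \<le> 1" by (intro power_le_one) auto
          then show ?thesis by (smt (verit) zero_le_power abs_ge_zero)
        next
          case False
          then have "\<bar>Y \<omega>\<bar> ^ Suc n \<le> \<bar>Y \<omega>\<bar> ^ Suc (Suc n)" by (intro power_increasing) auto
          then show ?thesis by linarith
        qed
        then show "norm (Y \<omega> ^ Suc n) \<le> norm (1 + \<bar>Y \<omega> ^ Suc (Suc n)\<bar>)"
          by (simp add: power_abs abs_mult)
      qed
    qed simp
    then have "P (Suc n)" using P_Suc n by blast
    then show ?thesis using P_Suc int2 by blast
  qed
  have P_even: "P (2 * m)" for m
    by (induction m) (use P0 P_Suc_Suc in auto)
  have "P n"
  proof (cases "even n")
    case True
    then show ?thesis using P_even by (auto elim: evenE)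
  next
    case False
    then obtain m where "n = Suc (2 * m)" by (auto elim: oddE)
    then show ?thesis using P_Suc_Suc[OF P_even] by simp
  qed
  then have "integrable N (\<lambda>\<omega>. Y \<omega> ^ n)"
    and "(CLINT \<omega>|N. of_real (Y \<omega> ^ n) * iexp (0 * Y \<omega>)) = (deriv ^^ n) G (\<i> * of_real 0)"
    unfolding P_def by blast+
  then show "integrable N (\<lambda>\<omega>. Y \<omega> ^ n)"
    and "of_real (LINT \<omega>|N. Y \<omega> ^ n) = (deriv ^^ n) G 0"
    by (simp_all add: integral_complex_of_real del: of_real_power)
qed

section \<open>Point masses as coefficients of the generating function\<close>

text \<open>
  Writing \<open>z ^ n\<close> as the series of \<open>indicator {i} n * z ^ i\<close> over \<open>i\<close> turns the integral into a power
  series; interchanging sum and integral is justified by comparison with the geometric series.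
\<close>
lemma pgf_sums:
  assumes "prob_space \<mu>" and sets: "sets \<mu> = sets (count_space UNIV)" and z: "cmod z < 1"
  shows "(\<lambda>n. of_real (measure \<mu> {n}) * z ^ n) sums pgf \<mu> z"
proof -
  interpret prob_space \<mu> by fact
  have [simp]: "A \<in> sets \<mu>" for A by (simp add: sets)
  let ?f = "\<lambda>i n. indicator {i} n *\<^sub>R z ^ i"
  have fin: "(\<lambda>i. ?f i n) sums z ^ n" for n
  proof -
    have "(\<lambda>i. ?f i n) = (\<lambda>i. if i = n then z ^ i else 0)" by (auto simp: indicator_def)
    then show ?thesis using sums_single[of n "\<lambda>i. z ^ i"] by (simp only:)
  qed
  have "(\<lambda>i. integral\<^sup>L \<mu> (?f i)) sums (\<integral>n. (\<Sum>i. ?f i n) \<partial>\<mu>)"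
  proof (rule sums_integral)
    show "integrable \<mu> (?f i)" for i
      by (auto intro!: integrable_scaleR_left integrable_real_indicator simp: less_top[symmetric])
    show "AE n in \<mu>. summable (\<lambda>i. norm (?f i n))"
      by (rule AE_I2, rule summable_finite[of "{_}"]) (auto simp: indicator_def)
    show "summable (\<lambda>i. \<integral>n. norm (?f i n) \<partial>\<mu>)"
    proof (rule summable_comparison_test)
      show "\<exists>N. \<forall>i\<ge>N. norm (\<integral>n. norm (?f i n) \<partial>\<mu>) \<le> cmod z ^ i"
        by (auto simp: norm_power abs_mult intro!: mult_left_le_one_le)
      show "summable (\<lambda>i. cmod z ^ i)" using z by (intro summable_geometric) simp
    qed
  qed
  moreover have "(\<Sum>i. ?f i n) = z ^ n" for n
    using fin by (rule sums_unique[symmetric])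
  moreover have "integral\<^sup>L \<mu> (?f i) = of_real (measure \<mu> {i}) * z ^ i" for i
    by (simp add: scaleR_conv_of_real)
  ultimately show ?thesis by (simp only: pgf_def)
qed

text \<open>Power series coefficients are unique, so any closed form of the generating function on the
  open unit disc determines the point masses.\<close>
lemma measure_eq_higher_deriv_pgf:
  assumes "prob_space \<mu>" and "sets \<mu> = sets (count_space UNIV)"
    and H: "\<And>z. cmod z < 1 \<Longrightarrow> pgf \<mu> z = H z"
  shows "of_real (measure \<mu> {n}) = (deriv ^^ n) H 0 / fact n"
proof -
  have "H has_fps_expansion Abs_fps (\<lambda>n. of_real (measure \<mu> {n}))"
  proof (rule has_fps_expansionI, rule eventually_nhds_in_open[of "ball 0 1", THEN eventually_mono])
    fix z :: complex assume "z \<in> ball 0 1"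
    then show "(\<lambda>n. fps_nth (Abs_fps (\<lambda>n. of_real (measure \<mu> {n}))) n * z ^ n) sums H z"
      using pgf_sums[OF assms(1,2)] H by simp
  qed auto
  from fps_nth_fps_expansion[OF this, of n] show ?thesis by simp
qed

section \<open>The identity for the discrete stable law\<close>

theorem theorem3p6:
  fixes M :: "'a measure" and N :: "'b measure"
    and X :: "'a \<Rightarrow> nat" and Y :: "'b \<Rightarrow> real"
    and \<gamma> lam :: real and k :: nat
  assumes "0 < \<gamma>" and "\<gamma> < 1" and "0 < lam"
    and "prob_space M"
    and "X \<in> measurable M (count_space UNIV)"
    and "is_PDS \<gamma> lam (distr M (count_space UNIV) X)"
    and "prob_space N"
    and "Y \<in> borel_measurable N"
    and "\<And>t. char (distr N borel Y) t =
           exp (- ((complex_of_real (lam powr (1 / \<gamma>)) - \<i> * complex_of_real t)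
                     powr complex_of_real \<gamma>) + complex_of_real lam)"
  shows "integrable N (\<lambda>\<omega>. Y \<omega> ^ k) \<and>
         measure M {\<omega> \<in> space M. X \<omega> = k} =
           exp (- lam) * (lam powr (real k / \<gamma>) / fact k) * (LINT \<omega>|N. Y \<omega> ^ k)"
proof -
  define c where "c = lam powr (1 / \<gamma>)"
  define G where "G = (\<lambda>s. exp (- ((of_real c - s) powr of_real \<gamma>) + complex_of_real lam))"
  define S where "S = {s. Re s < c}"
  have c: "0 < c" "c powr \<gamma> = lam" "c ^ k = lam powr (real k / \<gamma>)"
    using \<open>0 < \<gamma>\<close> \<open>0 < lam\<close> by (auto simp: c_def powr_powr powr_power)
  have S: "open S" unfolding S_def by (rule open_halfspace_Re_lt)
  have G: "G holomorphic_on S"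
    unfolding G_def S_def
    by (intro holomorphic_intros) (auto simp: complex_nonpos_Reals_iff)
  have S_imag: "\<i> * of_real t \<in> S" for t :: real
    using c by (simp add: S_def)
  have char: "char (distr N borel Y) t = G (\<i> * of_real t)" for t
    using assms(9) by (simp add: G_def c_def)
  note moments = moments_eq_higher_deriv[OF \<open>prob_space N\<close> \<open>Y \<in> borel_measurable N\<close> G S S_imag char]

  let ?\<mu> = "distr M (count_space UNIV) X"
  have pgf: "pgf ?\<mu> z = exp (- of_real lam) * G (of_real c * z)" if "cmod z < 1" for z
  proof -
    have "(complex_of_real c - complex_of_real c * z) powr of_real \<gamma>
        = of_real lam * (1 - z) powr of_real \<gamma>"
      using c powr_times_real_left[of "of_real c" "1 - z" "of_real \<gamma>"]
      by (simp add: right_diff_distrib powr_of_real)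
    then show ?thesis
      using assms(6) that by (simp add: is_PDS_def G_def flip: exp_add)
  qed
  have "of_real (measure ?\<mu> {k})
      = (deriv ^^ k) (\<lambda>z. exp (- of_real lam) * G (of_real c * z)) 0 / fact k"
    using assms(6) by (intro measure_eq_higher_deriv_pgf pgf) (auto simp: is_PDS_def)
  also have "(deriv ^^ k) (\<lambda>z. exp (- of_real lam) * G (of_real c * z)) 0
      = exp (- of_real lam) * (of_real c ^ k * (deriv ^^ k) G 0)"
  proof -
    have ball: "of_real c * w \<in> S" if "w \<in> ball 0 1" for w
      using that c complex_Re_le_cmod[of w] by (simp add: S_def)
    have "(\<lambda>z. G (of_real c * z)) holomorphic_on ball 0 1"
      using holomorphic_on_compose_gen[of "\<lambda>z. of_real c * z" "ball 0 1" G S] G ball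
      by (simp add: comp_def image_subset_iff holomorphic_intros)
    then have "(deriv ^^ k) (\<lambda>z. exp (- of_real lam) * G (of_real c * z)) 0
        = exp (- of_real lam) * (deriv ^^ k) (\<lambda>z. G (of_real c * z)) 0"
      by (intro higher_deriv_cmult[of _ "ball 0 1"]) auto
    then show ?thesis
      using higher_deriv_compose_linear[OF G open_ball S, of 0 0 1 "of_real c" k] ball by simp
  qed
  also have "\<dots> / fact k
      = of_real (exp (- lam) * (lam powr (real k / \<gamma>) / fact k) * (LINT \<omega>|N. Y \<omega> ^ k))"
    by (simp add: moments(2)[of k, symmetric] flip: c(3) exp_of_real)
  finally have "measure ?\<mu> {k}
      = exp (- lam) * (lam powr (real k / \<gamma>) / fact k) * (LINT \<omega>|N. Y \<omega> ^ k)"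
    by (simp only: of_real_eq_iff)
  moreover have "measure ?\<mu> {k} = measure M {\<omega> \<in> space M. X \<omega> = k}"
    using assms(5) by (simp add: measure_distr vimage_def Int_def conj_commute)
  ultimately show ?thesis using moments(1) by simp
qed

end
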